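(* Let $\theta$ be an inner function with $\theta^*=\theta$ and let $\phi\in L^\infty$. If the dual truncated Hankel operator $\mathcal{H}_\phi^\theta$ is hyponormal, then it is normal.
   Context: $\mathbb{T}$ is the unit circle with normalized Lebesgue measure, $L^2=L^2(\mathbb{T})$, $L^\infty=L^\infty(\mathbb{T})$. $H^2\subset L^2$ is the Hardy space (functions whose negative Fourier coefficients vanish), $H_0^2=zH^2$, $\overline{H_0^2}=L^2\ominus H^2$. $P:L^2\to H^2$ is the orthogonal projection and $Q=I-P$ is the orthogonal projection onto $\overline{H_0^2}$. The flip $J$ on $L^2$ is $(Jf)(z)=f(\bar z)$, $z\in\mathbb{T}$; $f^*(z)=\overline{f(\bar z)}$ for a function $f$ on $\mathbb{T}$. For an inner function $\theta$ (bounded analytic on the disk, unimodular a.e. on $\mathbb{T}$), $K_\theta=H^2\ominus\theta H^2$ and $K_\theta^\perp=L^2\ominus K_\theta=\overline{H_0^2}\oplus\theta H^2$; $Q_\theta=Q+\theta P\bar\theta$ is the orthogonal projection of $L^2$ onto $K_\theta^\perp$. For $\phi\in L^\infty$ the dual truncated Hankel operator is $\mathcal{H}_\phi^\theta:K_\theta^\perp\to K_\theta^\perp$, $\mathcal{H}_\phi^\theta(h)=Q_\theta J(\phi h)$. A bounded operator $T$ on a Hilbert space is hyponormal if $T^*T-TT^*$ is a positive (semidefinite) operator. *)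

theory Defs
  imports "HOL-Probability.Probability"
begin

section \<open>The unit circle with normalized Lebesgue measure\<close>

text \<open>The measure lives on the whole complex plane and is concentrated on the unit circle. Thus
  functions on the circle are Borel functions \<open>complex \<Rightarrow> complex\<close> (extended arbitrarily off the
  circle, e.g. by 0), and ``almost everywhere on the circle'' is \<open>AE z in circle\<close>.\<close>

definition circle :: "complex measure" where
  "circle = distr (uniform_measure lborel {0..2*pi}) borel cis"

lemma sets_circle [simp, measurable_cong]: "sets circle = sets borel"
  by (simp add: circle_def)

lemma space_circle [simp]: "space circle = UNIV"
  by (simp add: circle_def)

lemma measurable_circle [simp]: "measurable circle N = measurable borel N"
  by (rule measurable_cong_sets) simp_all

lemma measurable_cis [measurable]: "cis \<in> borel_measurable borel"
  by (intro borel_measurable_continuous_onI continuous_intros)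

lemma measurable_cnj' [measurable]: "cnj \<in> borel_measurable borel"
  by (intro borel_measurable_continuous_onI continuous_intros)

interpretation circle: prob_space circle
proof -
  interpret u: prob_space "uniform_measure lborel {0..2*pi}"
    by (rule prob_space_uniform_measure) auto
  show "prob_space circle"
    unfolding circle_def by (rule u.prob_space_distr) simp
qed

lemma AE_circle_norm: "AE z in circle. cmod z = 1"
  unfolding circle_def by (subst AE_distr_iff) auto

lemma distr_circle_cnj: "distr circle borel cnj = circle"
proof (rule measure_eqI)
  fix A :: "complex set" assume "A \<in> sets (distr circle borel cnj)"
  hence A [measurable]: "A \<in> sets borel" by simp
  let ?B = "{x\<in>{0..2*pi}. cis x \<in> A}"
  have B [measurable]: "?B \<in> sets borel" by measurable
  have *: "emeasure circle C = emeasure lborel {x\<in>{0..2*pi}. cis x \<in> C} / emeasure lborel {0..2*pi}"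
    if C [measurable]: "C \<in> sets borel" for C
  proof -
    have [measurable]: "cis -` C \<in> sets borel"
      using measurable_sets[OF measurable_cis C] by simp
    have "emeasure circle C = emeasure (uniform_measure lborel {0..2*pi}) (cis -` C)"
      unfolding circle_def by (subst emeasure_distr) auto
    also have "\<dots> = emeasure lborel ({0..2*pi} \<inter> cis -` C) / emeasure lborel {0..2*pi}"
      by (rule emeasure_uniform_measure) auto
    also have "{0..2*pi} \<inter> cis -` C = {x\<in>{0..2*pi}. cis x \<in> C}" by auto
    finally show ?thesis .
  qed
  have eq: "(\<lambda>x. 2*pi + -1 *\<^sub>R x) -` ?B = {x\<in>{0..2*pi}. cnj (cis x) \<in> A}"
    by (auto simp: cis_cnj cis.code complex_cnj)
  have m [measurable]: "cnj -` A \<in> sets borel"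
    using measurable_sets[OF measurable_cnj' A] by simp
  have "emeasure (distr circle borel cnj) A = emeasure circle (cnj -` A)"
    by (subst emeasure_distr) auto
  also have "\<dots> = emeasure lborel {x\<in>{0..2*pi}. cnj (cis x) \<in> A} / emeasure lborel {0..2*pi}"
    by (subst *) (auto simp: vimage_def m)
  also have "emeasure lborel {x\<in>{0..2*pi}. cnj (cis x) \<in> A} =
             emeasure lborel ((\<lambda>x. 2*pi + -1 *\<^sub>R x) -` ?B)"
    by (simp only: eq)
  also have "\<dots> = emeasure (distr lborel borel (\<lambda>x. 2*pi + -1 *\<^sub>R x)) ?B"
    by (subst emeasure_distr) auto
  also have "distr lborel borel (\<lambda>x. 2*pi + -1 *\<^sub>R x) = (lborel :: real measure)"
    using lborel_affine[of "-1" "2*pi"] by (simp add: density_1 lborel_distr_plus)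
  also have "emeasure lborel ?B / emeasure lborel {0..2*pi} = emeasure circle A"
    by (subst *) auto
  finally show "emeasure (distr circle borel cnj) A = emeasure circle A" .
qed simp

lemma AE_circle_cnj:
  assumes "AE z in circle. R z"
  shows "AE z in circle. R (cnj z)"
proof -
  have "AE z in distr circle borel cnj. R z"
    using assms by (simp only: distr_circle_cnj)
  thus ?thesis
    by (rule AE_distrD[rotated]) simp
qed


section \<open>The Hilbert space \<open>L2\<close> of the circle\<close>

definition square_integrable :: "(complex \<Rightarrow> complex) \<Rightarrow> bool" where
  "square_integrable f \<longleftrightarrow>
     f \<in> borel_measurable circle \<and> integrable circle (\<lambda>z. (cmod (f z))\<^sup>2)"

definition ess_bounded :: "(complex \<Rightarrow> complex) \<Rightarrow> bool" where
  "ess_bounded f \<longleftrightarrow>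
     f \<in> borel_measurable circle \<and> (\<exists>B. AE z in circle. cmod (f z) \<le> B)"

lemma square_integrable_measurable: "square_integrable f \<Longrightarrow> f \<in> borel_measurable circle"
  by (simp add: square_integrable_def)

lemma square_integrable_0: "square_integrable (\<lambda>_. 0)"
  by (simp add: square_integrable_def)

lemma square_integrable_add:
  assumes "square_integrable f" "square_integrable g"
  shows "square_integrable (\<lambda>z. f z + g z)"
proof -
  have [measurable]: "f \<in> borel_measurable circle" "g \<in> borel_measurable circle"
    using assms by (auto simp: square_integrable_def)
  have "integrable circle (\<lambda>z. 2 * (cmod (f z))\<^sup>2 + 2 * (cmod (g z))\<^sup>2)"
    using assms by (auto simp: square_integrable_def)
  moreover have "(cmod (f z + g z))\<^sup>2 \<le> 2 * (cmod (f z))\<^sup>2 + 2 * (cmod (g z))\<^sup>2" for z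
  proof -
    have "(cmod (f z + g z))\<^sup>2 \<le> (cmod (f z) + cmod (g z))\<^sup>2"
      by (intro power_mono norm_triangle_ineq) auto
    also have "\<dots> \<le> 2 * (cmod (f z))\<^sup>2 + 2 * (cmod (g z))\<^sup>2"
      using sum_squares_bound[of "cmod (f z)" "cmod (g z)"] by (simp add: power2_sum)
    finally show ?thesis .
  qed
  ultimately have "integrable circle (\<lambda>z. (cmod (f z + g z))\<^sup>2)"
    by - (rule Bochner_Integration.integrable_bound[where f = "\<lambda>z. 2 * (cmod (f z))\<^sup>2 + 2 * (cmod (g z))\<^sup>2"], auto)
  thus ?thesis by (simp add: square_integrable_def)
qed

lemma square_integrable_mult:
  assumes "ess_bounded c" "square_integrable f"
  shows "square_integrable (\<lambda>z. c z * f z)"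
proof -
  have [measurable]: "c \<in> borel_measurable circle" "f \<in> borel_measurable circle"
    using assms by (auto simp: square_integrable_def ess_bounded_def)
  from assms obtain B where B: "AE z in circle. cmod (c z) \<le> B"
    by (auto simp: ess_bounded_def)
  have "integrable circle (\<lambda>z. B\<^sup>2 * (cmod (f z))\<^sup>2)"
    using assms by (auto simp: square_integrable_def)
  hence "integrable circle (\<lambda>z. (cmod (c z * f z))\<^sup>2)"
  proof (rule Bochner_Integration.integrable_bound)
    show "AE z in circle. norm ((cmod (c z * f z))\<^sup>2) \<le> norm (B\<^sup>2 * (cmod (f z))\<^sup>2)"
      using B by eventually_elim (auto simp: norm_mult power_mult_distrib intro!: mult_right_mono power_mono)
  qed measurable
  thus ?thesis by (simp add: square_integrable_def)
qed

lemma square_integrable_cmult: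
  "square_integrable f \<Longrightarrow> square_integrable (\<lambda>z. c * f z)"
  by (rule square_integrable_mult) (auto simp: ess_bounded_def)

lemma square_integrable_scaleR:
  "square_integrable f \<Longrightarrow> square_integrable (\<lambda>z. r *\<^sub>R f z)"
  using square_integrable_cmult[of f "of_real r"] by (simp add: scaleR_conv_of_real)

lemma square_integrable_uminus:
  "square_integrable f \<Longrightarrow> square_integrable (\<lambda>z. - f z)"
  using square_integrable_cmult[of f "-1"] by simp

lemma square_integrable_diff:
  "square_integrable f \<Longrightarrow> square_integrable g \<Longrightarrow> square_integrable (\<lambda>z. f z - g z)"
  using square_integrable_add[of f "\<lambda>z. - g z"] square_integrable_uminus[of g] by simp

lemma square_integrable_flip:
  assumes "square_integrable f"
  shows "square_integrable (\<lambda>z. f (cnj z))"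
proof -
  have [measurable]: "f \<in> borel_measurable borel"
    using assms by (auto simp: square_integrable_def)
  have "integrable (distr circle borel cnj) (\<lambda>z. (cmod (f z))\<^sup>2)"
    using assms by (simp add: distr_circle_cnj square_integrable_def)
  hence "integrable circle (\<lambda>z. (cmod (f (cnj z)))\<^sup>2)"
    by (subst (asm) integrable_distr_eq) auto
  thus ?thesis by (simp add: square_integrable_def)
qed

lemma integrable_mult_cnj:
  assumes "square_integrable f" "square_integrable g"
  shows "integrable circle (\<lambda>z. f z * cnj (g z))"
proof -
  have [measurable]: "f \<in> borel_measurable circle" "g \<in> borel_measurable circle"
    using assms by (auto simp: square_integrable_def)
  have "integrable circle (\<lambda>z. (cmod (f z))\<^sup>2 + (cmod (g z))\<^sup>2)"
    using assms by (auto simp: square_integrable_def)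
  moreover have "cmod (f z) * cmod (g z) \<le> (cmod (f z))\<^sup>2 + (cmod (g z))\<^sup>2" for z
  proof -
    have "0 \<le> cmod (f z) * cmod (g z)" by simp
    thus ?thesis using sum_squares_bound[of "cmod (f z)" "cmod (g z)"] by linarith
  qed
  ultimately show ?thesis
    by - (rule Bochner_Integration.integrable_bound[where f = "\<lambda>z. (cmod (f z))\<^sup>2 + (cmod (g z))\<^sup>2"], auto simp: norm_mult)
qed

text \<open>Elements of \<open>L2\<close> are square integrable functions modulo equality almost everywhere.\<close>

quotient_type L2 = "complex \<Rightarrow> complex" / partial:
  "\<lambda>f g. square_integrable f \<and> square_integrable g \<and> (AE z in circle. f z = g z)"
proof (rule part_equivpI)
  show "\<exists>f. square_integrable f \<and> square_integrable f \<and> (AE z in circle. f z = f z)"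
    using square_integrable_0 by auto
  show "symp (\<lambda>f g. square_integrable f \<and> square_integrable g \<and> (AE z in circle. f z = g z))"
    by (auto simp: symp_def eq_commute)
  show "transp (\<lambda>f g. square_integrable f \<and> square_integrable g \<and> (AE z in circle. f z = g z))"
    by (intro transpI) (elim conjE, intro conjI, assumption+, erule (1) eventually_elim2, simp)
qed

lift_definition cinner :: "L2 \<Rightarrow> L2 \<Rightarrow> complex" is
  "\<lambda>f g. \<integral>z. f z * cnj (g z) \<partial>circle"
proof (elim conjE, rule integral_cong_AE, goal_cases)
  case (1 f f' g g')
  thus ?case by (auto dest!: square_integrable_measurable)
next
  case (2 f f' g g')
  thus ?case by (auto dest!: square_integrable_measurable)
next
  case (3 f f' g g')
  from 3(4,6) show ?case by eventually_elim simp
qed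

lift_definition scaleC :: "complex \<Rightarrow> L2 \<Rightarrow> L2" is "\<lambda>c f z. c * f z"
  by (elim conjE, intro conjI square_integrable_cmult, assumption+, erule eventually_mono, simp)

instantiation L2 :: real_inner
begin

lift_definition zero_L2 :: L2 is "\<lambda>_. 0"
  by (simp add: square_integrable_0)

lift_definition plus_L2 :: "L2 \<Rightarrow> L2 \<Rightarrow> L2" is "\<lambda>f g z. f z + g z"
  by (elim conjE, intro conjI square_integrable_add, assumption+, erule (1) eventually_elim2, simp)

lift_definition minus_L2 :: "L2 \<Rightarrow> L2 \<Rightarrow> L2" is "\<lambda>f g z. f z - g z"
  by (elim conjE, intro conjI square_integrable_diff, assumption+, erule (1) eventually_elim2, simp)

lift_definition uminus_L2 :: "L2 \<Rightarrow> L2" is "\<lambda>f z. - f z"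
  by (elim conjE, intro conjI square_integrable_uminus, assumption+, erule eventually_mono, simp)

lift_definition scaleR_L2 :: "real \<Rightarrow> L2 \<Rightarrow> L2" is "\<lambda>r f z. r *\<^sub>R f z"
  by (elim conjE, intro conjI square_integrable_scaleR, assumption+, erule eventually_mono, simp)

definition inner_L2 :: "L2 \<Rightarrow> L2 \<Rightarrow> real" where
  "inner_L2 f g = Re (cinner f g)"

definition norm_L2 :: "L2 \<Rightarrow> real" where
  "norm_L2 f = sqrt (Re (cinner f f))"

definition dist_L2 :: "L2 \<Rightarrow> L2 \<Rightarrow> real" where
  "dist_L2 f g = norm (f - g)"

definition sgn_L2 :: "L2 \<Rightarrow> L2" where
  "sgn_L2 f = inverse (norm f) *\<^sub>R f"

definition uniformity_L2 :: "(L2 \<times> L2) filter" where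
  "uniformity_L2 = (INF e\<in>{0<..}. principal {(x, y). dist x y < e})"

definition open_L2 :: "L2 set \<Rightarrow> bool" where
  "open_L2 U = (\<forall>x\<in>U. eventually (\<lambda>(x', y). x' = x \<longrightarrow> y \<in> U) uniformity)"

instance
proof
  fix f g h :: L2 and a b :: real
  show "f + g + h = f + (g + h)"
    by transfer (auto simp: add.assoc intro!: square_integrable_add)
  show "f + g = g + f"
    by transfer (auto simp: add.commute intro!: square_integrable_add)
  show "0 + f = f"
    by transfer (auto simp: square_integrable_0)
  show "- f + f = 0"
    by transfer (auto simp: square_integrable_0)
  show "f - g = f + - g"
    by transfer (auto intro: square_integrable_diff)
  show "a *\<^sub>R (f + g) = a *\<^sub>R f + a *\<^sub>R g"
    by transfer (auto simp: scaleR_add_right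
          intro!: square_integrable_add square_integrable_scaleR simp del: scaleR_conv_of_real)
  show "(a + b) *\<^sub>R f = a *\<^sub>R f + b *\<^sub>R f"
    by transfer (auto simp: scaleR_add_left
          intro!: square_integrable_add square_integrable_scaleR simp del: scaleR_conv_of_real)
  show "a *\<^sub>R b *\<^sub>R f = (a * b) *\<^sub>R f"
    by transfer (auto intro!: square_integrable_scaleR simp del: scaleR_conv_of_real)
  show "1 *\<^sub>R f = f"
    by transfer auto
  show "dist f g = norm (f - g)" by (fact dist_L2_def)
  show "sgn f = inverse (norm f) *\<^sub>R f" by (fact sgn_L2_def)
  show "uniformity = (INF e\<in>{0<..}. principal {(x, y :: L2). dist x y < e})"
    by (fact uniformity_L2_def)
  show "open U = (\<forall>x\<in>U. eventually (\<lambda>(x', y). x' = x \<longrightarrow> y \<in> U) uniformity)" for U :: "L2 set"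
    by (fact open_L2_def)
  have cnj: "cinner f g = cnj (cinner g f)"
    by transfer (subst Bochner_Integration.integral_cnj [symmetric], simp add: mult.commute)
  show "inner f g = inner g f"
    unfolding inner_L2_def by (subst cnj) simp
  have "cinner (f + g) h = cinner f h + cinner g h"
    by transfer (auto simp: ring_distribs integrable_mult_cnj)
  thus "inner (f + g) h = inner f h + inner g h"
    by (simp add: inner_L2_def)
  have "cinner (a *\<^sub>R f) g = a *\<^sub>R cinner f g"
    by transfer (simp add: scaleR_conv_of_real mult.assoc)
  thus "inner (a *\<^sub>R f) g = a * inner f g"
    by (simp add: inner_L2_def)
  have sq: "Re (cinner f f) \<ge> 0 \<and> (Re (cinner f f) = 0 \<longleftrightarrow> f = 0)"
  proof (transfer, goal_cases)
    case (1 f)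
    hence f: "square_integrable f" by simp
    have [measurable]: "f \<in> borel_measurable circle"
      using f by (rule square_integrable_measurable)
    have "Re (\<integral>z. f z * cnj (f z) \<partial>circle) = (\<integral>z. (cmod (f z))\<^sup>2 \<partial>circle)"
      by (simp only: complex_norm_square [symmetric] integral_complex_of_real Re_complex_of_real)
    moreover have "(\<integral>z. (cmod (f z))\<^sup>2 \<partial>circle) = 0 \<longleftrightarrow> (AE z in circle. f z = 0)"
      using f by (subst integral_nonneg_eq_0_iff_AE) (auto simp: square_integrable_def)
    ultimately show ?case using f by (auto simp: square_integrable_0)
  qed
  show "0 \<le> inner f f" "inner f f = 0 \<longleftrightarrow> f = 0"
    using sq by (simp_all add: inner_L2_def)
  show "norm f = sqrt (inner f f)"
    by (simp add: norm_L2_def inner_L2_def)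
qed

end

text \<open>Multiplication by a bounded function; the value 0 for functions outside \<open>L\<^sup>\<infinity>\<close> is a dummy.\<close>

lift_definition mult_op :: "(complex \<Rightarrow> complex) \<Rightarrow> L2 \<Rightarrow> L2" is
  "\<lambda>\<phi> f. if ess_bounded \<phi> then (\<lambda>z. \<phi> z * f z) else (\<lambda>_. 0)"
  by (auto intro: square_integrable_mult square_integrable_0)

lift_definition flip_op :: "L2 \<Rightarrow> L2" is "\<lambda>f z. f (cnj z)"
  by (elim conjE, intro conjI square_integrable_flip, assumption+, erule AE_circle_cnj)

lift_definition fourier_coeff :: "L2 \<Rightarrow> int \<Rightarrow> complex" is
  "\<lambda>f n. \<integral>z. f z * cnj (z powi n) \<partial>circle"
proof (rule ext, goal_cases)
  case (1 f g n)
  have [measurable]: "(\<lambda>z::complex. z powi n) \<in> borel_measurable borel"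
    unfolding power_int_def by measurable
  have [measurable]: "f \<in> borel_measurable circle" "g \<in> borel_measurable circle"
    using 1 by (auto dest: square_integrable_measurable)
  show ?case
    using 1 by (intro integral_cong_AE) (auto elim!: eventually_mono)
qed


section \<open>Subspaces and operators of \<open>L2\<close>\<close>

definition orth_compl :: "L2 set \<Rightarrow> L2 set" where
  "orth_compl M = {f. \<forall>g\<in>M. cinner f g = 0}"

definition orth_proj :: "L2 set \<Rightarrow> L2 \<Rightarrow> L2" where
  "orth_proj M f = (THE g. g \<in> M \<and> f - g \<in> orth_compl M)"

text \<open>An operator on a closed subspace \<open>S\<close> is given by a function on \<open>L2\<close> of which only the
  values on \<open>S\<close> matter.\<close>

definition bounded_operator_on :: "L2 set \<Rightarrow> (L2 \<Rightarrow> L2) \<Rightarrow> bool" where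
  "bounded_operator_on S T \<longleftrightarrow>
     T ` S \<subseteq> S \<and>
     (\<forall>x\<in>S. \<forall>y\<in>S. T (x + y) = T x + T y) \<and>
     (\<forall>c. \<forall>x\<in>S. T (scaleC c x) = scaleC c (T x)) \<and>
     (\<exists>B. \<forall>x\<in>S. norm (T x) \<le> B * norm x)"

definition adjoint_on :: "L2 set \<Rightarrow> (L2 \<Rightarrow> L2) \<Rightarrow> L2 \<Rightarrow> L2" where
  "adjoint_on S T y = (THE w. w \<in> S \<and> (\<forall>x\<in>S. cinner (T x) y = cinner x w))"

definition positive_on :: "L2 set \<Rightarrow> (L2 \<Rightarrow> L2) \<Rightarrow> bool" where
  "positive_on S A \<longleftrightarrow> (\<forall>x\<in>S. cinner (A x) x \<in> \<real>\<^sub>\<ge>\<^sub>0)"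

definition hyponormal_on :: "L2 set \<Rightarrow> (L2 \<Rightarrow> L2) \<Rightarrow> bool" where
  "hyponormal_on S T \<longleftrightarrow>
     bounded_operator_on S T \<and>
     positive_on S (\<lambda>x. adjoint_on S T (T x) - T (adjoint_on S T x))"

definition normal_on :: "L2 set \<Rightarrow> (L2 \<Rightarrow> L2) \<Rightarrow> bool" where
  "normal_on S T \<longleftrightarrow>
     bounded_operator_on S T \<and>
     (\<forall>x\<in>S. adjoint_on S T (T x) = T (adjoint_on S T x))"


section \<open>Hardy space, inner functions, dual truncated Hankel operators\<close>

definition H2 :: "L2 set" where
  "H2 = {f. \<forall>n<0. fourier_coeff f n = 0}"

definition P_H2 :: "L2 \<Rightarrow> L2" where
  "P_H2 = orth_proj H2"

definition Q_H2 :: "L2 \<Rightarrow> L2" where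
  "Q_H2 f = f - P_H2 f"

text \<open>An inner function is represented by its boundary function \<open>\<theta>\<close> on the circle; \<open>F\<close> is the
  analytic function on the disk having \<open>\<theta>\<close> as radial limit almost everywhere.\<close>

definition inner_function :: "(complex \<Rightarrow> complex) \<Rightarrow> bool" where
  "inner_function \<theta> \<longleftrightarrow>
     \<theta> \<in> borel_measurable circle \<and>
     (\<exists>F. F holomorphic_on ball 0 1 \<and> bounded (F ` ball 0 1) \<and>
          (AE z in circle. ((\<lambda>r. F (of_real r * z)) \<longlongrightarrow> \<theta> z) (at_left 1))) \<and>
     (AE z in circle. cmod (\<theta> z) = 1)"

definition star :: "(complex \<Rightarrow> complex) \<Rightarrow> complex \<Rightarrow> complex" where
  "star f z = cnj (f (cnj z))"

definition model_space :: "(complex \<Rightarrow> complex) \<Rightarrow> L2 set" where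
  "model_space \<theta> = H2 \<inter> orth_compl (mult_op \<theta> ` H2)"

definition Q_inner :: "(complex \<Rightarrow> complex) \<Rightarrow> L2 \<Rightarrow> L2" where
  "Q_inner \<theta> f = Q_H2 f + mult_op \<theta> (P_H2 (mult_op (\<lambda>z. cnj (\<theta> z)) f))"

definition dual_truncated_Hankel ::
    "(complex \<Rightarrow> complex) \<Rightarrow> (complex \<Rightarrow> complex) \<Rightarrow> L2 \<Rightarrow> L2" where
  "dual_truncated_Hankel \<theta> \<phi> h = Q_inner \<theta> (flip_op (mult_op \<phi> h))"

end

theory Submission
  imports Defs "HOL-Complex_Analysis.Cauchy_Integral_Formula"
begin

text \<open>The reason for the theorem is a symmetry. Let \<open>C f = f\<^sup>*\<close>, that is, \<open>(C f)(z)\<close> is the complex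
  conjugate of \<open>f\<close> at the conjugate of \<open>z\<close>. This is an antilinear isometric involution of \<open>L2\<close>. It
  leaves the Hardy space invariant, and since \<open>\<theta>\<^sup>* = \<theta>\<close> it also leaves \<open>\<theta> H2\<close>, the model space and the
  orthogonal complement \<open>S\<close> of the model space invariant. Conjugating the product of the flip and
  multiplication by \<open>\<phi>\<close> with \<open>C\<close> gives its adjoint. Compressing to \<open>S\<close> shows that the dual truncated
  Hankel operator \<open>T\<close> satisfies \<open>T\<^sup>* = C T C\<close> (lemma \<open>cinner_dual_truncated_Hankel\<close>).

  A hyponormal operator with this symmetry is normal (theorem
  \<open>complex_symmetric_hyponormal_imp_normal\<close>): with \<open>D = T\<^sup>* T - T T\<^sup>*\<close> one has \<open>C D C = - D\<close>, so
  positivity of \<open>D\<close> forces its quadratic form, and then \<open>D\<close> itself, to vanish.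

  The compression argument needs \<open>f - Q\<^sub>\<theta> f\<close> to lie in the model space
  (lemma \<open>diff_Q_inner_in_model_space\<close>), and this rests on two pieces of analysis. First, the
  orthogonal projection onto the Hardy space must exist, which requires the completeness of \<open>L2\<close>.
  Second, multiplication by an inner function must map the Hardy space into itself
  (lemma \<open>inner_function_mult_H2\<close>), which is derived from the radial limits of the bounded analytic
  extension.\<close>

section \<open>Completeness of \<open>L2\<close>\<close>

lemma square_integrable_rep_L2: "square_integrable (rep_L2 x)"
  using Quotient3_rep_reflp[OF Quotient3_L2] by simp

lemma abs_rep_L2: "abs_L2 (rep_L2 x) = x"
  using Quotient3_abs_rep[OF Quotient3_L2] by simp

lemma norm_diff_abs_L2:
  assumes "square_integrable f" "square_integrable g"
  shows "(norm (abs_L2 f - abs_L2 g))\<^sup>2 = (\<integral>z. (cmod (f z - g z))\<^sup>2 \<partial>circle)"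
proof -
  have "abs_L2 f - abs_L2 g = abs_L2 (\<lambda>z. f z - g z)"
    using assms by (simp add: minus_L2.abs_eq)
  hence "(norm (abs_L2 f - abs_L2 g))\<^sup>2 = Re (cinner (abs_L2 (\<lambda>z. f z - g z)) (abs_L2 (\<lambda>z. f z - g z)))"
    by (simp add: power2_norm_eq_inner inner_L2_def)
  also have "\<dots> = Re (\<integral>z. (f z - g z) * cnj (f z - g z) \<partial>circle)"
    using assms by (simp add: cinner.abs_eq square_integrable_diff)
  finally show ?thesis
    by (simp only: complex_norm_square [symmetric] integral_complex_of_real Re_complex_of_real)
qed

lemma nn_integral_norm_diff_rep_L2:
  "(\<integral>\<^sup>+z. ennreal ((cmod (rep_L2 x z - rep_L2 y z))\<^sup>2) \<partial>circle) = ennreal ((norm (x - y))\<^sup>2)"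
proof -
  have "square_integrable (\<lambda>z. rep_L2 x z - rep_L2 y z)"
    by (intro square_integrable_diff square_integrable_rep_L2)
  thus ?thesis
    using norm_diff_abs_L2[OF square_integrable_rep_L2[of x] square_integrable_rep_L2[of y]]
    by (subst nn_integral_eq_integral) (auto simp: square_integrable_def abs_rep_L2)
qed

text \<open>The telescoping series of increments converges absolutely almost everywhere because the
  \<open>L1\<close> norms of the increments are summable. These norms are controlled by the \<open>L2\<close> norms through
  the elementary bound \<open>t \<le> 2\<^sup>-\<^sup>n + 2\<^sup>n t\<^sup>2\<close>, integrated over the probability space \<open>circle\<close>.\<close>
lemma fast_subseq_AE_convergent:
  fixes X :: "nat \<Rightarrow> L2"
  assumes "\<And>n. norm (X (Suc n) - X n) \<le> (1/2) ^ n"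
  shows "AE z in circle. convergent (\<lambda>n. rep_L2 (X n) z)"
proof -
  define g where "g n z = rep_L2 (X (Suc n)) z - rep_L2 (X n) z" for n z
  have [measurable]: "rep_L2 x \<in> borel_measurable borel" for x
    using square_integrable_rep_L2[of x] by (simp add: square_integrable_def)
  have [measurable]: "g n \<in> borel_measurable borel" for n
    unfolding g_def by measurable
  have "(\<integral>\<^sup>+z. ennreal (cmod (g n z)) \<partial>circle) \<le> ennreal (2 * (1/2) ^ n)" for n
  proof -
    have *: "cmod w \<le> (1/2)^n + 2^n * (cmod w)\<^sup>2" for w
    proof -
      have "0 \<le> (2^n * cmod w - 1)\<^sup>2" by simp
      hence "2 * 2^n * cmod w \<le> 1 + (2^n)\<^sup>2 * (cmod w)\<^sup>2"
        by (simp add: power2_eq_square algebra_simps)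
      moreover have "(0::real) < 2 ^ n" by simp
      moreover have "2^n * cmod w \<ge> 0" by simp
      moreover have "2^n * ((1/2)^n + 2^n * (cmod w)\<^sup>2) = 1 + (2^n)\<^sup>2 * (cmod w)\<^sup>2"
        by (simp add: power2_eq_square power_one_over distrib_left mult.assoc)
      ultimately have "2^n * cmod w \<le> 2^n * ((1/2)^n + 2^n * (cmod w)\<^sup>2)"
        by linarith
      thus ?thesis by simp
    qed
    have "(\<integral>\<^sup>+z. ennreal (cmod (g n z)) \<partial>circle)
        \<le> (\<integral>\<^sup>+z. ennreal ((1/2)^n) + ennreal (2^n) * ennreal ((cmod (g n z))\<^sup>2) \<partial>circle)"
      by (intro nn_integral_mono)
         (metis "*" ennreal_leI ennreal_mult'' ennreal_plus zero_le_power2 zero_le_power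
            zero_le_numeral zero_le_divide_1_iff mult_nonneg_nonneg)
    also have "\<dots> = ennreal ((1/2)^n) + ennreal (2^n) * ennreal ((norm (X (Suc n) - X n))\<^sup>2)"
      by (simp add: nn_integral_add nn_integral_cmult g_def nn_integral_norm_diff_rep_L2
            circle.emeasure_space_1[simplified])
    also have "\<dots> = ennreal ((1/2)^n + 2^n * (norm (X (Suc n) - X n))\<^sup>2)"
      by (simp add: ennreal_mult'')
    also have "\<dots> \<le> ennreal ((1/2)^n + 2^n * ((1/2)^n)\<^sup>2)"
      using assms by (intro ennreal_leI add_left_mono mult_left_mono power_mono) auto
    also have "(1/2)^n + 2^n * ((1/2)^n)\<^sup>2 = (2 * (1/2)^n :: real)"
      by (simp add: power2_eq_square power_one_over)
    finally show ?thesis .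
  qed
  hence "(\<Sum>n. \<integral>\<^sup>+z. ennreal (cmod (g n z)) \<partial>circle) \<le> (\<Sum>n. ennreal (2 * (1/2) ^ n))"
    by (intro suminf_le) auto
  also have "\<dots> < \<infinity>"
    by (subst suminf_ennreal2) (auto intro!: summable_mult summable_geometric)
  finally have "(\<integral>\<^sup>+z. (\<Sum>n. ennreal (cmod (g n z))) \<partial>circle) < \<infinity>"
    by (subst nn_integral_suminf) auto
  hence "AE z in circle. (\<Sum>n. ennreal (cmod (g n z))) \<noteq> \<infinity>"
    by (intro nn_integral_PInf_AE) auto
  thus ?thesis
  proof eventually_elim
    case (elim z)
    hence "summable (\<lambda>n. cmod (g n z))"
      by (intro summable_suminf_not_top) auto
    hence "summable (\<lambda>n. g n z)" by (rule summable_norm_cancel)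
    hence "convergent (\<lambda>n. \<Sum>i<n. rep_L2 (X (Suc i)) z - rep_L2 (X i) z)"
      by (simp add: summable_iff_convergent g_def)
    hence "convergent (\<lambda>n. rep_L2 (X n) z - rep_L2 (X 0) z)"
      unfolding sum_lessThan_telescope[of "\<lambda>i. rep_L2 (X i) z"] .
    thus ?case
      by (rule convergent_diff_const_right_iff[THEN iffD1])
  qed
qed

text \<open>Riesz-Fischer: a rapidly converging subsequence has a pointwise limit almost everywhere, and
  Fatou's lemma shows that this limit is square integrable and is also the limit in norm.\<close>
instance L2 :: complete_space
proof
  fix X :: "nat \<Rightarrow> L2" assume X: "Cauchy X"
  have "\<exists>r. strict_mono r \<and> (\<forall>n. norm (X (r (Suc n)) - X (r n)) \<le> (1/2) ^ n)"
  proof -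
    have "\<exists>N. \<forall>m\<ge>N. \<forall>k\<ge>N. norm (X m - X k) < (1/2) ^ n" for n :: nat
      using CauchyD[OF X, of "(1/2)^n"] by simp
    then obtain N where N: "\<And>n m k. m \<ge> N n \<Longrightarrow> k \<ge> N n \<Longrightarrow> norm (X m - X k) < (1/2) ^ n"
      by metis
    define r where "r = rec_nat (N 0) (\<lambda>n k. max (Suc k) (N (Suc n)))"
    have r: "r 0 = N 0" "r (Suc n) = max (Suc (r n)) (N (Suc n))" for n
      by (simp_all add: r_def)
    have mono: "strict_mono r"
      by (rule strict_monoI_Suc) (simp add: r)
    have "r n \<ge> N n" for n by (cases n) (auto simp: r)
    moreover have "r (Suc n) \<ge> r n" for n by (simp add: r)
    ultimately have "norm (X (r (Suc n)) - X (r n)) \<le> (1/2) ^ n" for n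
      by (meson N less_imp_le order_trans)
    with mono show ?thesis by blast
  qed
  then obtain r where r: "strict_mono r" "\<And>n. norm (X (r (Suc n)) - X (r n)) \<le> (1/2) ^ n"
    by blast
  define f where "f n = rep_L2 (X (r n))" for n
  have f: "square_integrable (f n)" for n
    by (simp add: f_def square_integrable_rep_L2)
  have [measurable]: "f n \<in> borel_measurable borel" for n
    using f[of n] by (simp add: square_integrable_def)
  define h where "h z = lim (\<lambda>n. f n z)" for z
  have [measurable]: "h \<in> borel_measurable borel"
    unfolding h_def by measurable
  have lim: "AE z in circle. (\<lambda>n. f n z) \<longlonglongrightarrow> h z"
    using fast_subseq_AE_convergent[of "\<lambda>n. X (r n)", OF r(2)]
    by eventually_elim (simp add: f_def h_def convergent_LIMSEQ_iff)
  have Xr: "Cauchy (\<lambda>n. X (r n))"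
    using Cauchy_subseq_Cauchy[OF X r(1)] by (simp add: o_def)
  have bound: "\<exists>M. \<forall>m\<ge>M. (\<integral>\<^sup>+z. ennreal ((cmod (h z - f m z))\<^sup>2) \<partial>circle) \<le> ennreal (e\<^sup>2)"
    if e: "e > 0" for e
  proof -
    obtain M where M: "\<And>m n. m \<ge> M \<Longrightarrow> n \<ge> M \<Longrightarrow> norm (X (r n) - X (r m)) < e"
      using CauchyD[OF Xr e] by blast
    have "(\<integral>\<^sup>+z. ennreal ((cmod (h z - f m z))\<^sup>2) \<partial>circle) \<le> ennreal (e\<^sup>2)" if m: "m \<ge> M" for m
    proof -
      have "(\<integral>\<^sup>+z. ennreal ((cmod (h z - f m z))\<^sup>2) \<partial>circle)
          = (\<integral>\<^sup>+z. liminf (\<lambda>n. ennreal ((cmod (f n z - f m z))\<^sup>2)) \<partial>circle)"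
      proof (rule nn_integral_cong_AE)
        show "AE z in circle. ennreal ((cmod (h z - f m z))\<^sup>2)
            = liminf (\<lambda>n. ennreal ((cmod (f n z - f m z))\<^sup>2))"
          using lim
        proof eventually_elim
          case (elim z)
          hence "(\<lambda>n. ennreal ((cmod (f n z - f m z))\<^sup>2)) \<longlonglongrightarrow> ennreal ((cmod (h z - f m z))\<^sup>2)"
            by (intro tendsto_intros)
          thus ?case by (rule lim_imp_Liminf[OF trivial_limit_sequentially, symmetric])
        qed
      qed
      also have "\<dots> \<le> liminf (\<lambda>n. \<integral>\<^sup>+z. ennreal ((cmod (f n z - f m z))\<^sup>2) \<partial>circle)"
        by (rule nn_integral_liminf) measurable
      also have "\<dots> = liminf (\<lambda>n. ennreal ((norm (X (r n) - X (r m)))\<^sup>2))"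
        by (simp add: f_def nn_integral_norm_diff_rep_L2)
      also have "\<dots> \<le> limsup (\<lambda>n. ennreal ((norm (X (r n) - X (r m)))\<^sup>2))"
        by (intro Liminf_le_Limsup) simp
      also have "\<dots> \<le> ennreal (e\<^sup>2)"
        by (intro Limsup_bounded eventually_sequentiallyI[of M] ennreal_leI power_mono
              less_imp_le[OF M] m norm_ge_zero)
      finally show ?thesis .
    qed
    thus ?thesis by blast
  qed
  have "square_integrable h"
  proof -
    obtain m where "(\<integral>\<^sup>+z. ennreal ((cmod (h z - f m z))\<^sup>2) \<partial>circle) \<le> ennreal (1\<^sup>2)"
      using bound[OF zero_less_one] by blast
    also have "\<dots> < \<infinity>" by simp
    finally have "square_integrable (\<lambda>z. h z - f m z)"
      by (simp add: square_integrable_def integrable_iff_bounded)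
    from square_integrable_add[OF this f[of m]] show ?thesis by simp
  qed
  have "(\<lambda>n. X (r n)) \<longlonglongrightarrow> abs_L2 h"
  proof (rule metric_LIMSEQ_I)
    fix e :: real assume e: "e > 0"
    then obtain M where M: "\<And>m. m \<ge> M \<Longrightarrow>
        (\<integral>\<^sup>+z. ennreal ((cmod (h z - f m z))\<^sup>2) \<partial>circle) \<le> ennreal ((e/2)\<^sup>2)"
      using bound[OF half_gt_zero[OF e]] by blast
    have "dist (X (r m)) (abs_L2 h) < e" if "m \<ge> M" for m
    proof -
      have "(norm (abs_L2 h - X (r m)))\<^sup>2 = (\<integral>z. (cmod (h z - f m z))\<^sup>2 \<partial>circle)"
        using norm_diff_abs_L2[OF \<open>square_integrable h\<close> f[of m]]
        by (simp add: f_def abs_rep_L2)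
      also have "\<dots> \<le> (e/2)\<^sup>2"
      proof -
        have "square_integrable (\<lambda>z. h z - f m z)"
          by (intro square_integrable_diff f \<open>square_integrable h\<close>)
        hence "ennreal (\<integral>z. (cmod (h z - f m z))\<^sup>2 \<partial>circle)
            = (\<integral>\<^sup>+z. ennreal ((cmod (h z - f m z))\<^sup>2) \<partial>circle)"
          by (subst nn_integral_eq_integral) (auto simp: square_integrable_def)
        also note M[OF that]
        finally show ?thesis by simp
      qed
      finally have "norm (abs_L2 h - X (r m)) \<le> e/2"
        using e by (simp add: power2_le_imp_le[of _ "e/2"])
      thus ?thesis using e by (simp add: dist_norm norm_minus_commute)
    qed
    thus "\<exists>M. \<forall>m\<ge>M. dist (X (r m)) (abs_L2 h) < e" by blast
  qed
  hence "X \<longlonglongrightarrow> abs_L2 h"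
    by (intro Cauchy_converges_subseq[OF X r(1)]) (unfold o_def)
  thus "convergent X" by (auto simp: convergent_def)
qed

section \<open>Orthogonal projections\<close>

text \<open>By the parallelogram law, a sequence in the subspace whose distances to \<open>f\<close> approach the infimum
  is a Cauchy sequence; its limit attains the infimum.\<close>
lemma nearest_point_exists:
  fixes V :: "'a :: {real_inner, complete_space} set"
  assumes V: "subspace V" "closed V"
  shows "\<exists>g\<in>V. \<forall>v\<in>V. norm (f - g) \<le> norm (f - v)"
proof -
  define d where "d = (INF v\<in>V. (norm (f - v))\<^sup>2)"
  have ne: "V \<noteq> {}" using V(1) subspace_0 by blast
  have bdd: "bdd_below ((\<lambda>v. (norm (f - v))\<^sup>2) ` V)"
    by (rule bdd_belowI2[of _ 0]) simp
  have d_le: "d \<le> (norm (f - v))\<^sup>2" if "v \<in> V" for v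
    unfolding d_def by (rule cINF_lower[OF bdd that])
  have "\<exists>v\<in>V. (norm (f - v))\<^sup>2 < d + inverse (real (Suc n))" for n
    using cInf_less_iff[of "(\<lambda>v. (norm (f - v))\<^sup>2) ` V" "d + inverse (real (Suc n))"] ne bdd
    by (auto simp: d_def)
  then obtain v where v: "\<And>n. v n \<in> V" "\<And>n. (norm (f - v n))\<^sup>2 < d + inverse (real (Suc n))"
    by metis
  have par: "(norm (v m - v n))\<^sup>2 \<le> 2 * inverse (real (Suc m)) + 2 * inverse (real (Suc n))" for m n
  proof -
    have "(1/2) *\<^sub>R (v m + v n) \<in> V"
      using V(1) v(1) by (intro subspace_scale subspace_add)
    hence "4 * d \<le> 4 * (norm (f - (1/2) *\<^sub>R (v m + v n)))\<^sup>2"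
      using d_le by simp
    also have "\<dots> = 2 * (norm (f - v m))\<^sup>2 + 2 * (norm (f - v n))\<^sup>2 - (norm (v m - v n))\<^sup>2"
      unfolding power2_norm_eq_inner
      by (simp add: inner_diff_left inner_diff_right inner_add_left inner_add_right inner_commute)
    finally show ?thesis using v(2)[of m] v(2)[of n] by linarith
  qed
  have "Cauchy v"
  proof (rule CauchyI)
    fix e :: real assume e: "e > 0"
    then obtain N where N: "inverse (real (Suc N)) < e\<^sup>2 / 4"
      using reals_Archimedean[of "e\<^sup>2 / 4"] by auto
    have "norm (v m - v n) < e" if "m \<ge> N" "n \<ge> N" for m n
    proof -
      have "inverse (real (Suc m)) \<le> inverse (real (Suc N))" "inverse (real (Suc n)) \<le> inverse (real (Suc N))"
        using that by (auto simp: field_simps)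
      hence "(norm (v m - v n))\<^sup>2 < e\<^sup>2" using par[of m n] N by linarith
      thus ?thesis using e by (auto intro: power2_less_imp_less)
    qed
    thus "\<exists>N. \<forall>m\<ge>N. \<forall>n\<ge>N. norm (v m - v n) < e" by blast
  qed
  then obtain g where g: "v \<longlonglongrightarrow> g"
    using Cauchy_convergent_iff convergent_def by blast
  have "g \<in> V"
    using closed_sequentially[OF V(2)] v(1) g by blast
  have "(\<lambda>n. (norm (f - v n))\<^sup>2) \<longlonglongrightarrow> (norm (f - g))\<^sup>2"
    by (intro tendsto_intros g)
  moreover have "(\<lambda>n. d + inverse (real (Suc n))) \<longlonglongrightarrow> d + 0"
    by (intro tendsto_intros LIMSEQ_inverse_real_of_nat)
  ultimately have "(norm (f - g))\<^sup>2 \<le> d + 0"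
    by (rule LIMSEQ_le) (use v(2) in \<open>auto intro: less_imp_le\<close>)
  hence sq_le: "(norm (f - g))\<^sup>2 \<le> (norm (f - u))\<^sup>2" if "u \<in> V" for u
    using d_le[OF that] by linarith
  have "norm (f - g) \<le> norm (f - u)" if "u \<in> V" for u
    by (rule power2_le_imp_le[OF sq_le[OF that] norm_ge_zero])
  with \<open>g \<in> V\<close> show ?thesis by blast
qed

text \<open>At the nearest point \<open>g\<close> the residual \<open>f - g\<close> is orthogonal to the subspace: otherwise moving
  from \<open>g\<close> in the direction \<open>v\<close> by the real projection coefficient would decrease the distance.\<close>
lemma orthogonal_projection_exists:
  fixes V :: "'a :: {real_inner, complete_space} set"
  assumes V: "subspace V" "closed V"
  shows "\<exists>g\<in>V. \<forall>v\<in>V. inner (f - g) v = 0"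
proof -
  obtain g where g: "g \<in> V" "\<And>v. v \<in> V \<Longrightarrow> norm (f - g) \<le> norm (f - v)"
    using nearest_point_exists[OF V] by blast
  have "inner (f - g) v = 0" if v: "v \<in> V" for v
  proof (cases "v = 0")
    case False
    define t where "t = inner (f - g) v / inner v v"
    have "g + t *\<^sub>R v \<in> V"
      using V(1) g(1) v by (intro subspace_add subspace_scale)
    hence "(norm (f - g))\<^sup>2 \<le> (norm ((f - g) - t *\<^sub>R v))\<^sup>2"
      using g(2) by (intro power_mono) (auto simp: diff_diff_eq)
    also have "\<dots> = (norm (f - g))\<^sup>2 - 2 * t * inner (f - g) v + t\<^sup>2 * inner v v"
      unfolding power2_norm_eq_inner
      by (simp add: inner_diff_left inner_diff_right inner_commute power2_eq_square algebra_simps)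
    also have "\<dots> = (norm (f - g))\<^sup>2 - (inner (f - g) v)\<^sup>2 / inner v v"
      using False by (simp add: t_def power2_eq_square)
    finally have "(inner (f - g) v)\<^sup>2 / inner v v \<le> 0" by simp
    moreover have "inner v v > 0" using False by simp
    ultimately show ?thesis
      by (simp add: divide_le_0_iff)
  qed simp
  with g(1) show ?thesis by blast
qed

lemma cinner_commute: "cinner f g = cnj (cinner g f)"
  by transfer (subst Bochner_Integration.integral_cnj [symmetric], simp add: mult.commute)

lemma cinner_add_left: "cinner (f + g) h = cinner f h + cinner g h"
  by transfer (auto simp: ring_distribs integrable_mult_cnj)

lemma cinner_scaleC_left: "cinner (scaleC c f) g = c * cinner f g"
  by transfer (simp add: mult.assoc)

lemma cinner_add_right: "cinner h (f + g) = cinner h f + cinner h g"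
  using cinner_add_left[of f g h] cinner_commute[of h] by simp

lemma cinner_scaleC_right: "cinner g (scaleC c f) = cnj c * cinner g f"
  using cinner_scaleC_left[of c f g] cinner_commute[of g] by simp

lemma scaleR_eq_scaleC: "r *\<^sub>R f = scaleC (of_real r) f"
  by transfer (auto simp: scaleR_conv_of_real intro: square_integrable_cmult)

lemma uminus_eq_scaleC: "- f = scaleC (- 1) f"
  by transfer (auto intro: square_integrable_uminus)

lemma cinner_diff_left: "cinner (f - g) h = cinner f h - cinner g h"
  using cinner_add_left[of "f - g" g h] by simp

lemma cinner_diff_right: "cinner h (f - g) = cinner h f - cinner h g"
  using cinner_add_right[of h "f - g" g] by simp

lemma cinner_0_left [simp]: "cinner 0 f = 0"
  using cinner_diff_left[of 0 0 f] by simp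

lemma cinner_0_right [simp]: "cinner f 0 = 0"
  using cinner_diff_right[of f 0 0] by simp

lemma scaleC_add_right: "scaleC c (f + g) = scaleC c f + scaleC c g"
  by transfer (auto simp: ring_distribs intro!: square_integrable_add square_integrable_cmult)

lemma cinner_self_eq_0: "cinner f f = 0 \<Longrightarrow> f = 0"
  using inner_eq_zero_iff[of f] by (simp add: inner_L2_def)

text \<open>This reduces complex orthogonality to the real inner product, so that the projection theorem
  for real inner product spaces applies to complex subspaces.\<close>
lemma cinner_eq_0_iff_inner:
  "cinner f g = 0 \<longleftrightarrow> inner f g = 0 \<and> inner f (scaleC \<i> g) = 0"
  by (auto simp: inner_L2_def cinner_scaleC_right complex_eq_iff)

definition complex_subspace :: "L2 set \<Rightarrow> bool" where
  "complex_subspace S \<longleftrightarrow>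
     0 \<in> S \<and> (\<forall>x\<in>S. \<forall>y\<in>S. x + y \<in> S) \<and> (\<forall>c. \<forall>x\<in>S. scaleC c x \<in> S)"

lemma complex_subspace_add: "complex_subspace S \<Longrightarrow> x \<in> S \<Longrightarrow> y \<in> S \<Longrightarrow> x + y \<in> S"
  and complex_subspace_scaleC: "complex_subspace S \<Longrightarrow> x \<in> S \<Longrightarrow> scaleC c x \<in> S"
  by (auto simp: complex_subspace_def)

lemma complex_subspace_diff: "complex_subspace S \<Longrightarrow> x \<in> S \<Longrightarrow> y \<in> S \<Longrightarrow> x - y \<in> S"
  using complex_subspace_add[of S x "scaleC (-1) y"] complex_subspace_scaleC[of S y "-1"]
  by (simp flip: uminus_eq_scaleC)

lemma complex_subspace_imp_subspace: "complex_subspace S \<Longrightarrow> subspace S"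
  by (auto simp: complex_subspace_def subspace_def scaleR_eq_scaleC)

lemma complex_subspace_orth_compl: "complex_subspace (orth_compl M)"
  by (auto simp: complex_subspace_def orth_compl_def cinner_add_left cinner_scaleC_left)

lemma closed_orth_compl: "closed (orth_compl M)"
proof -
  have "orth_compl M = (\<Inter>g\<in>M. {f. inner f g = 0} \<inter> {f. inner f (scaleC \<i> g) = 0})"
    by (auto simp: orth_compl_def cinner_eq_0_iff_inner)
  moreover have "closed {f :: L2. inner f g = 0}" for g
    by (intro closed_Collect_eq continuous_intros)
  ultimately show ?thesis by (auto intro!: closed_INT closed_Int)
qed

text \<open>The description that defines \<^const>\<open>orth_proj\<close> is meaningful on every subspace that is itself
  an orthogonal complement, since such a subspace is closed.\<close>
lemma orth_proj_orth_compl: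
  assumes S: "S = orth_compl M"
  shows "orth_proj S f \<in> S" and "f - orth_proj S f \<in> orth_compl S"
proof -
  have sub: "complex_subspace S" and cl: "closed S"
    by (simp_all add: S complex_subspace_orth_compl closed_orth_compl)
  obtain g where g: "g \<in> S" "\<And>v. v \<in> S \<Longrightarrow> inner (f - g) v = 0"
    using orthogonal_projection_exists[OF complex_subspace_imp_subspace[OF sub] cl] by blast
  have "f - g \<in> orth_compl S"
    using g(2) complex_subspace_scaleC[OF sub]
    by (auto simp: orth_compl_def cinner_eq_0_iff_inner)
  moreover have "h = g" if h: "h \<in> S" "f - h \<in> orth_compl S" for h
  proof -
    have "h - g \<in> S" using h(1) g(1) by (rule complex_subspace_diff[OF sub])
    moreover have "h - g \<in> orth_compl S"
      using complex_subspace_diff[OF complex_subspace_orth_compl \<open>f - g \<in> orth_compl S\<close> h(2)]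
      by simp
    ultimately have "cinner (h - g) (h - g) = 0" by (simp add: orth_compl_def)
    thus ?thesis using cinner_self_eq_0 by fastforce
  qed
  ultimately have "\<exists>!g. g \<in> S \<and> f - g \<in> orth_compl S" using g(1) by blast
  from theI'[OF this]
  show "orth_proj S f \<in> S" "f - orth_proj S f \<in> orth_compl S"
    by (simp_all add: orth_proj_def)
qed

section \<open>Hyponormal complex symmetric operators\<close>

lemma adjoint_on_eqI:
  assumes "complex_subspace S" "w \<in> S" "\<And>x. x \<in> S \<Longrightarrow> cinner (T x) y = cinner x w"
  shows "adjoint_on S T y = w"
  unfolding adjoint_on_def
proof (rule the_equality)
  show "w \<in> S \<and> (\<forall>x\<in>S. cinner (T x) y = cinner x w)"
    using assms by blast
next
  fix v assume v: "v \<in> S \<and> (\<forall>x\<in>S. cinner (T x) y = cinner x v)"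
  have "v - w \<in> S" using v assms(2) by (intro complex_subspace_diff[OF assms(1)]) auto
  hence "cinner (v - w) (v - w) = 0"
    using v assms(3) by (simp add: cinner_diff_right)
  thus "v = w" using cinner_self_eq_0 by fastforce
qed

text \<open>Complex polarization: comparing the vanishing of the form at \<open>x + D x\<close> and at \<open>\<i> x + D x\<close>
  isolates \<open>\<langle>D x, D x\<rangle>\<close>.\<close>
lemma quadratic_form_eq_0:
  assumes S: "complex_subspace S"
    and D: "\<And>x. x \<in> S \<Longrightarrow> D x \<in> S"
    and add: "\<And>x y. x \<in> S \<Longrightarrow> y \<in> S \<Longrightarrow> D (x + y) = D x + D y"
    and scale: "\<And>c x. x \<in> S \<Longrightarrow> D (scaleC c x) = scaleC c (D x)"
    and zero: "\<And>x. x \<in> S \<Longrightarrow> cinner (D x) x = 0"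
    and x: "x \<in> S"
  shows "D x = 0"
proof -
  have pol: "cinner (D u) v + cinner (D v) u = 0" if "u \<in> S" "v \<in> S" for u v
    using zero[OF complex_subspace_add[OF S that]] zero that
    by (simp add: add cinner_add_left cinner_add_right add.commute)
  have "cinner (D x) (D x) + cinner (D (D x)) x = 0"
    by (intro pol x D)
  moreover have "\<i> * cinner (D x) (D x) - \<i> * cinner (D (D x)) x = 0"
    using pol[OF complex_subspace_scaleC[OF S x, of \<i>] D[OF x]]
    by (simp add: scale x cinner_scaleC_left cinner_scaleC_right)
  ultimately have "cinner (D x) (D x) = 0" by simp
  thus ?thesis by (rule cinner_self_eq_0)
qed

text \<open>Let \<open>D = T\<^sup>* T - T T\<^sup>*\<close>. The symmetry hypothesis says \<open>T\<^sup>* = C T C\<close>, and conjugating by \<open>C\<close>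
  exchanges the two terms of \<open>D\<close>, so \<open>C D C = - D\<close>. The quadratic form of \<open>D\<close> at \<open>C x\<close> is therefore
  the negative of its value at \<open>x\<close>, while hyponormality makes both values nonnegative. Hence the
  form vanishes, and so does \<open>D\<close>.\<close>
theorem complex_symmetric_hyponormal_imp_normal:
  assumes S: "complex_subspace S"
    and C: "\<And>x. x \<in> S \<Longrightarrow> C x \<in> S" "\<And>x. C (C x) = x"
      "\<And>x y. C (x + y) = C x + C y" "\<And>c x. C (scaleC c x) = scaleC (cnj c) (C x)"
      "\<And>x y. cinner (C x) (C y) = cinner y x"
    and sym: "\<And>x y. x \<in> S \<Longrightarrow> y \<in> S \<Longrightarrow> cinner (T x) y = cinner x (C (T (C y)))"
    and hyp: "hyponormal_on S T"
  shows "normal_on S T"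
proof -
  have T: "T x \<in> S" "x \<in> S \<Longrightarrow> y \<in> S \<Longrightarrow> T (x + y) = T x + T y"
      "T (scaleC c x) = scaleC c (T x)" if "x \<in> S" for x y c
    using hyp that unfolding hyponormal_on_def bounded_operator_on_def by auto
  define T' where "T' y = C (T (C y))" for y
  have T': "T' y \<in> S" if "y \<in> S" for y
    using that by (simp add: T'_def C T)
  have adj: "adjoint_on S T y = T' y" if "y \<in> S" for y
    using S T'[OF that] by (rule adjoint_on_eqI) (simp add: T'_def sym that)
  define D where "D x = T' (T x) - T (T' x)" for x
  have C_diff: "C (x - y) = C x - C y" for x y
    using C(3)[of "x - y" y] by simp
  have D_S: "D x \<in> S" if "x \<in> S" for x
    unfolding D_def using that by (intro complex_subspace_diff[OF S] T T')
  have D_add: "D (x + y) = D x + D y" if "x \<in> S" "y \<in> S" for x y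
    using that by (simp add: D_def T'_def T C)
  have D_scale: "D (scaleC c x) = scaleC c (D x)" if "x \<in> S" for x c
  proof -
    have "scaleC c (u - v) = scaleC c u - scaleC c v" for u v
      using scaleC_add_right[of c "u - v" v] by simp
    thus ?thesis using that by (simp add: D_def T'_def T C)
  qed
  have pos: "cinner (D x) x \<in> \<real>\<^sub>\<ge>\<^sub>0" if "x \<in> S" for x
    using hyp that by (simp add: hyponormal_on_def positive_on_def adj T D_def)
  have "cinner (D x) x = 0" if x: "x \<in> S" for x
  proof -
    have "D (C x) = - C (D x)"
      by (simp add: D_def T'_def C C_diff)
    hence "cinner (D (C x)) (C x) = - cinner x (D x)"
      by (simp add: uminus_eq_scaleC cinner_scaleC_left C(5))
    also have "\<dots> = - cnj (cinner (D x) x)"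
      by (subst cinner_commute) simp
    finally have "- cnj (cinner (D x) x) \<in> \<real>\<^sub>\<ge>\<^sub>0"
      using pos[OF C(1)[OF x]] by simp
    with pos[OF x] show ?thesis
      by (auto simp: complex_nonneg_Reals_iff complex_eq_iff)
  qed
  hence "D x = 0" if "x \<in> S" for x
    using quadratic_form_eq_0[OF S D_S D_add D_scale _ that] by blast
  hence "\<forall>x\<in>S. adjoint_on S T (T x) = T (adjoint_on S T x)"
    by (simp add: adj T D_def)
  thus ?thesis using hyp by (simp add: normal_on_def hyponormal_on_def)
qed

section \<open>Inner functions multiply the Hardy space into itself\<close>

lemma AE_circle_cnj_powi: "AE z in circle. cnj z powi n = z powi (- n)"
  using AE_circle_norm
proof eventually_elim
  case (elim z)
  hence "cnj z = inverse z"
    by (metis complex_norm_square inverse_unique of_real_1 power_one)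
  thus ?case by (simp add: power_int_inverse power_int_minus)
qed

lemma measurable_powi [measurable]: "(\<lambda>z::complex. z powi n) \<in> borel_measurable borel"
  unfolding power_int_def by measurable

lift_definition monomial :: "int \<Rightarrow> L2" is "\<lambda>n z. z powi n"
proof -
  fix n :: int
  have "AE z in circle. (cmod (z powi n))\<^sup>2 = 1"
    using AE_circle_norm by eventually_elim (simp add: norm_power_int)
  hence "integrable circle (\<lambda>z. (cmod (z powi n))\<^sup>2) \<longleftrightarrow> integrable circle (\<lambda>z. 1 :: real)"
    by (intro integrable_cong_AE) auto
  thus "square_integrable (\<lambda>z. z powi n) \<and> square_integrable (\<lambda>z. z powi n) \<and>
      (AE z in circle. z powi n = z powi n)"
    by (simp add: square_integrable_def)
qed

lemma fourier_coeff_eq_cinner: "fourier_coeff f n = cinner f (monomial n)"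
  by transfer simp

text \<open>In this form the Hardy space falls under the projection lemma \<open>orth_proj_orth_compl\<close>.\<close>
lemma H2_eq_orth_compl: "H2 = orth_compl (monomial ` {..<0})"
  by (auto simp: H2_def orth_compl_def fourier_coeff_eq_cinner)

lemma square_integrable_imp_integrable: "square_integrable h \<Longrightarrow> integrable circle h"
  using integrable_mult_cnj[of h "\<lambda>_. 1"] by (simp add: square_integrable_def)

text \<open>The partial sums of an absolutely convergent power series are uniformly bounded on the circle,
  so the series may be integrated against \<open>h\<close> term by term, and each term is a vanishing Fourier
  coefficient of \<open>h\<close>.\<close>
lemma integral_power_series_mult_eq_0:
  fixes a :: "nat \<Rightarrow> complex"
  assumes h: "integrable circle h" and neg: "\<And>k. (\<integral>z. h z * z ^ (k + m) \<partial>circle) = 0"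
    and a: "summable (\<lambda>k. cmod (a k))"
  shows "(\<integral>z. (\<Sum>k. a k * z ^ k) * h z * z ^ m \<partial>circle) = 0"
proof -
  have [measurable]: "h \<in> borel_measurable borel" using h by auto
  have int: "integrable circle (\<lambda>z. h z * z ^ k)" for k
  proof (rule Bochner_Integration.integrable_bound[OF h])
    show "AE z in circle. norm (h z * z ^ k) \<le> norm (h z)"
      using AE_circle_norm by eventually_elim (simp add: norm_mult norm_power)
  qed measurable
  have "(\<lambda>N. \<integral>z. (\<Sum>k<N. a k * z ^ k) * h z * z ^ m \<partial>circle)
      \<longlonglongrightarrow> (\<integral>z. (\<Sum>k. a k * z ^ k) * h z * z ^ m \<partial>circle)"
  proof (rule integral_dominated_convergence)
    show "integrable circle (\<lambda>z. (\<Sum>k. cmod (a k)) * cmod (h z))"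
      using h by auto
    show "AE z in circle. (\<lambda>N. (\<Sum>k<N. a k * z ^ k) * h z * z ^ m)
        \<longlonglongrightarrow> (\<Sum>k. a k * z ^ k) * h z * z ^ m"
      using AE_circle_norm
    proof eventually_elim
      case (elim z)
      have "summable (\<lambda>k. a k * z ^ k)"
        by (rule summable_norm_cancel) (simp add: norm_mult norm_power elim a)
      thus ?case by (intro tendsto_intros summable_LIMSEQ)
    qed
    show "AE z in circle. norm ((\<Sum>k<N. a k * z ^ k) * h z * z ^ m) \<le> (\<Sum>k. cmod (a k)) * cmod (h z)" for N
      using AE_circle_norm
    proof eventually_elim
      case (elim z)
      have "norm (\<Sum>k<N. a k * z ^ k) \<le> (\<Sum>k<N. norm (a k * z ^ k))" by (rule norm_sum)
      also have "\<dots> = (\<Sum>k<N. cmod (a k))" by (simp add: norm_mult norm_power elim)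
      also have "\<dots> \<le> (\<Sum>k. cmod (a k))" by (rule sum_le_suminf[OF a]) auto
      finally show ?case by (auto simp: norm_mult norm_power elim intro: mult_right_mono)
    qed
  qed measurable
  moreover have "(\<integral>z. (\<Sum>k<N. a k * z ^ k) * h z * z ^ m \<partial>circle) = 0" for N
  proof -
    have "(\<integral>z. (\<Sum>k<N. a k * z ^ k) * h z * z ^ m \<partial>circle)
        = (\<integral>z. (\<Sum>k<N. a k * (h z * z ^ (k + m))) \<partial>circle)"
      by (simp add: sum_distrib_left power_add mult_ac)
    also have "\<dots> = (\<Sum>k<N. a k * (\<integral>z. h z * z ^ (k + m) \<partial>circle))"
      by (subst Bochner_Integration.integral_sum) (auto intro: int)
    finally show ?thesis by (simp add: neg)
  qed
  ultimately show ?thesis by (simp add: LIMSEQ_const_iff)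
qed

lemma ess_bounded_cnj: "ess_bounded f \<Longrightarrow> ess_bounded (\<lambda>z. cnj (f z))"
  by (auto simp: ess_bounded_def intro: measurable_compose[OF _ measurable_cnj'])

lemma inner_function_imp_ess_bounded:
  assumes "inner_function \<theta>"
  shows "ess_bounded \<theta>" "ess_bounded (\<lambda>z. cnj (\<theta> z))"
proof -
  show *: "ess_bounded \<theta>"
    using assms unfolding inner_function_def ess_bounded_def by (auto intro!: exI[of _ 1])
  show "ess_bounded (\<lambda>z. cnj (\<theta> z))" by (rule ess_bounded_cnj[OF *])
qed

text \<open>For the analytic extension \<open>F\<close> of \<open>\<theta>\<close> and a radius \<open>r < 1\<close>, the function \<open>F (r z)\<close> is given on
  the circle by an absolutely convergent power series, so the preceding lemma applies to it.
  Since \<open>F\<close> is bounded, the radial limit \<open>r \<rightarrow> 1\<close> may be taken under the integral.\<close>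
lemma inner_function_mult_integral_eq_0:
  assumes \<theta>: "inner_function \<theta>"
    and h: "integrable circle h" and neg: "\<And>k. (\<integral>z. h z * z ^ (k + m) \<partial>circle) = 0"
  shows "(\<integral>z. \<theta> z * h z * z ^ m \<partial>circle) = 0"
proof -
  have [measurable]: "h \<in> borel_measurable borel" using h by auto
  have [measurable]: "\<theta> \<in> borel_measurable borel" using \<theta> by (simp add: inner_function_def)
  obtain F where F: "F holomorphic_on ball 0 1" "bounded (F ` ball 0 1)"
      "AE z in circle. ((\<lambda>r. F (of_real r * z)) \<longlongrightarrow> \<theta> z) (at_left 1)"
    using \<theta> by (auto simp: inner_function_def)
  obtain B where B: "\<And>w. w \<in> ball 0 1 \<Longrightarrow> cmod (F w) \<le> B"
    using F(2) unfolding bounded_iff by blast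
  define a where "a k = (deriv ^^ k) F 0 / fact k" for k
  have a: "(\<lambda>k. a k * w ^ k) sums F w" if "w \<in> ball 0 1" for w
    using holomorphic_power_series[OF F(1) that] by (simp add: a_def)
  define r where "r j = 1 - inverse (real (Suc j))" for j
  have r: "0 \<le> r j" "r j < 1" for j by (auto simp: r_def field_simps)
  have r_lim: "filterlim r (at_left 1) sequentially"
  proof -
    have "(\<lambda>j. 1 - inverse (real (Suc j))) \<longlonglongrightarrow> 1 - 0"
      by (intro tendsto_intros LIMSEQ_inverse_real_of_nat)
    thus ?thesis
      using r by (simp add: filterlim_at r_def[abs_def])
  qed
  \<comment> \<open>\<open>G\<close> agrees with \<open>F (r j * z)\<close> on the circle and, unlike the latter, is evidently Borel
    measurable on the whole plane, where \<open>F\<close> is arbitrary outside the disk.\<close>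
  define G where "G j z = (\<Sum>k. a k * of_real (r j) ^ k * z ^ k)" for j z
  have [measurable]: "G j \<in> borel_measurable borel" for j
    unfolding G_def by measurable
  have G: "G j z = F (of_real (r j) * z)" "of_real (r j) * z \<in> ball 0 1" if "cmod z = 1" for j z
  proof -
    show w: "of_real (r j) * z \<in> ball 0 1" using r[of j] that by (simp add: norm_mult)
    show "G j z = F (of_real (r j) * z)"
      using a[OF w] by (simp add: G_def sums_iff power_mult_distrib mult.assoc)
  qed
  have "(\<integral>z. G j z * h z * z ^ m \<partial>circle) = 0" for j
  proof -
    \<comment> \<open>Convergence at the larger radius \<open>\<rho>\<close> yields absolute convergence at \<open>r j\<close>.\<close>
    define \<rho> where "\<rho> = (r j + 1) / 2"
    have \<rho>: "r j < \<rho>" "\<rho> < 1" "0 \<le> \<rho>" using r[of j] by (auto simp: \<rho>_def)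
    have "summable (\<lambda>k. a k * of_real \<rho> ^ k)"
      using a[of "of_real \<rho>"] \<rho> by (simp add: sums_iff)
    hence "summable (\<lambda>k. norm (a k * of_real (r j) ^ k))"
      by (rule powser_insidea) (use \<rho> r[of j] in auto)
    thus ?thesis
      unfolding G_def by (intro integral_power_series_mult_eq_0 h neg)
  qed
  moreover have "(\<lambda>j. \<integral>z. G j z * h z * z ^ m \<partial>circle) \<longlonglongrightarrow> (\<integral>z. \<theta> z * h z * z ^ m \<partial>circle)"
  proof (rule integral_dominated_convergence)
    show "integrable circle (\<lambda>z. B * cmod (h z))" using h by auto
    show "AE z in circle. (\<lambda>j. G j z * h z * z ^ m) \<longlonglongrightarrow> \<theta> z * h z * z ^ m"
      using F(3) AE_circle_norm
    proof eventually_elim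
      case (elim z)
      have "(\<lambda>j. G j z) \<longlonglongrightarrow> \<theta> z"
        using filterlim_compose[OF elim(1) r_lim] by (simp add: G(1)[OF elim(2)])
      thus ?case by (intro tendsto_intros)
    qed
    show "AE z in circle. norm (G j z * h z * z ^ m) \<le> B * cmod (h z)" for j
      using AE_circle_norm
    proof eventually_elim
      case (elim z)
      have "cmod (G j z) \<le> B" using G[OF elim] B by simp
      thus ?case by (auto simp: norm_mult norm_power elim intro: mult_right_mono)
    qed
  qed measurable
  ultimately show ?thesis by (simp add: LIMSEQ_const_iff)
qed

lemma inner_function_mult_H2:
  assumes \<theta>: "inner_function \<theta>" and f: "f \<in> H2"
  shows "mult_op \<theta> f \<in> H2"
proof -
  define h where "h = rep_L2 f"
  have sq: "square_integrable h" and f_eq: "f = abs_L2 h"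
    by (simp_all add: h_def square_integrable_rep_L2 abs_rep_L2)
  have [measurable]: "h \<in> borel_measurable borel" "\<theta> \<in> borel_measurable borel"
    using sq \<theta> by (simp_all add: square_integrable_def inner_function_def)
  have conv: "(\<integral>z. g z * (cnj z powi (- int k)) \<partial>circle) = (\<integral>z. g z * z ^ k \<partial>circle)"
    if [measurable]: "g \<in> borel_measurable borel" for g k
    using AE_circle_cnj_powi[of "- int k"]
    by (intro integral_cong_AE) (auto elim!: eventually_mono)
  have sq': "square_integrable (\<lambda>z. \<theta> z * h z)"
    by (intro square_integrable_mult inner_function_imp_ess_bounded \<theta> sq)
  have "fourier_coeff (mult_op \<theta> f) n = 0" if n: "n < 0" for n
  proof -
    define m where "m = nat (- n)"
    have m: "m > 0" "n = - int m" using n by (auto simp: m_def)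
    have "(\<integral>z. h z * z ^ (k + m) \<partial>circle) = 0" for k
    proof -
      have "fourier_coeff f (- int (k + m)) = 0"
        using f m(1) by (simp add: H2_def)
      thus ?thesis
        using sq by (subst conv[symmetric]) (simp_all add: f_eq fourier_coeff.abs_eq)
    qed
    hence "(\<integral>z. \<theta> z * h z * z ^ m \<partial>circle) = 0"
      by (rule inner_function_mult_integral_eq_0[OF \<theta> square_integrable_imp_integrable[OF sq]])
    thus ?thesis
      using sq sq' inner_function_imp_ess_bounded(1)[OF \<theta>]
      by (simp add: f_eq mult_op.abs_eq fourier_coeff.abs_eq m(2) conv)
  qed
  thus ?thesis by (simp add: H2_def)
qed

lemma cinner_mult_op_left:
  assumes "ess_bounded \<phi>"
  shows "cinner (mult_op \<phi> f) g = cinner f (mult_op (\<lambda>z. cnj (\<phi> z)) g)"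
  using assms ess_bounded_cnj[OF assms] by transfer (simp add: mult_ac)

lemma mult_op_cnj_inner_function:
  assumes "inner_function \<theta>"
  shows "mult_op (\<lambda>z. cnj (\<theta> z)) (mult_op \<theta> f) = f"
proof -
  have "AE z in circle. cnj (\<theta> z) * (\<theta> z * w z) = w z" for w
  proof -
    have "AE z in circle. cmod (\<theta> z) = 1"
      using assms by (simp add: inner_function_def)
    thus ?thesis
    proof eventually_elim
      case (elim z)
      have "cnj (\<theta> z) * \<theta> z = 1"
        using complex_norm_square[of "\<theta> z"] elim by (simp add: mult.commute)
      thus ?case by (simp flip: mult.assoc)
    qed
  qed
  with inner_function_imp_ess_bounded[OF assms] show ?thesis
    by transfer (auto intro!: square_integrable_mult)
qed

lemma P_H2: "P_H2 f \<in> H2" "f - P_H2 f \<in> orth_compl H2"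
  unfolding P_H2_def by (rule orth_proj_orth_compl[OF H2_eq_orth_compl])+

section \<open>The dual truncated Hankel operator is complex symmetric\<close>

text \<open>Here \<open>f - Q\<^sub>\<theta> f = P f - \<theta> P (\<theta>\<^sup>- f)\<close>, writing \<open>\<theta>\<^sup>-\<close> for the conjugate of \<open>\<theta>\<close>. Both terms lie in
  the Hardy space. Against \<open>\<theta> h\<close> with \<open>h\<close> in the Hardy space they have the same inner product
  \<open>\<langle>f, \<theta> h\<rangle>\<close>, because \<open>P\<close> can be dropped and \<open>\<theta>\<close> is unimodular.\<close>
lemma diff_Q_inner_in_model_space:
  assumes \<theta>: "inner_function \<theta>"
  shows "f - Q_inner \<theta> f \<in> model_space \<theta>"
proof -
  let ?g = "mult_op (\<lambda>z. cnj (\<theta> z)) f"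
  have eq: "f - Q_inner \<theta> f = P_H2 f - mult_op \<theta> (P_H2 ?g)"
    by (simp add: Q_inner_def Q_H2_def)
  have "complex_subspace H2"
    unfolding H2_eq_orth_compl by (rule complex_subspace_orth_compl)
  hence "f - Q_inner \<theta> f \<in> H2"
    unfolding eq by (intro complex_subspace_diff inner_function_mult_H2 \<theta> P_H2)
  moreover have "cinner (f - Q_inner \<theta> f) (mult_op \<theta> h) = 0" if h: "h \<in> H2" for h
  proof -
    have "cinner (P_H2 f) (mult_op \<theta> h) = cinner f (mult_op \<theta> h)"
      using P_H2(2)[of f] inner_function_mult_H2[OF \<theta> h]
      by (simp add: orth_compl_def cinner_diff_left)
    moreover have "cinner (mult_op \<theta> (P_H2 ?g)) (mult_op \<theta> h) = cinner (P_H2 ?g) h"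
      by (simp add: cinner_mult_op_left inner_function_imp_ess_bounded \<theta> mult_op_cnj_inner_function)
    moreover have "cinner (P_H2 ?g) h = cinner ?g h"
      using P_H2(2)[of ?g] h by (simp add: orth_compl_def cinner_diff_left)
    moreover have "cinner ?g h = cinner f (mult_op \<theta> h)"
      by (simp add: cinner_mult_op_left inner_function_imp_ess_bounded \<theta>)
    ultimately show ?thesis by (simp add: eq cinner_diff_left)
  qed
  ultimately show ?thesis by (auto simp: model_space_def orth_compl_def)
qed

text \<open>Against vectors of its range the projection can be omitted; the symmetry of the Hankel operator
  rests on this.\<close>
lemma cinner_Q_inner_left:
  assumes "inner_function \<theta>" "y \<in> orth_compl (model_space \<theta>)"
  shows "cinner (Q_inner \<theta> f) y = cinner f y"
proof -
  have "cinner y (f - Q_inner \<theta> f) = 0"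
    using diff_Q_inner_in_model_space[OF assms(1)] assms(2) by (simp add: orth_compl_def)
  hence "cinner (f - Q_inner \<theta> f) y = 0" by (subst cinner_commute) simp
  thus ?thesis by (simp add: cinner_diff_left)
qed

lemma integral_circle_cnj:
  fixes f :: "complex \<Rightarrow> complex"
  assumes "f \<in> borel_measurable borel"
  shows "(\<integral>z. f (cnj z) \<partial>circle) = (\<integral>z. f z \<partial>circle)"
  using integral_distr[of cnj circle borel f] assms by (simp add: distr_circle_cnj)

lemma cinner_flip_op_left: "cinner (flip_op f) g = cinner f (flip_op g)"
proof (transfer, goal_cases)
  case (1 f g)
  hence [measurable]: "f \<in> borel_measurable borel" "g \<in> borel_measurable borel"
    by (auto simp: square_integrable_def)
  show ?case
    using integral_circle_cnj[of "\<lambda>z. f z * cnj (g (cnj z))"] by simp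
qed

lemma square_integrable_cnj: "square_integrable f \<Longrightarrow> square_integrable (\<lambda>z. cnj (f z))"
  by (auto simp: square_integrable_def intro: measurable_compose[OF _ measurable_cnj'])

lemma square_integrable_star: "square_integrable f \<Longrightarrow> square_integrable (star f)"
  unfolding star_def by (intro square_integrable_cnj square_integrable_flip)

text \<open>The conjugation \<open>f \<mapsto> f\<^sup>*\<close>, an antilinear isometric involution. It fixes all monomials \<open>z\<^sup>n\<close>, and
  hence leaves the Hardy space invariant.\<close>
lift_definition star_op :: "L2 \<Rightarrow> L2" is star
proof (elim conjE, intro conjI square_integrable_star)
  show "AE z in circle. star f z = star g z" if "AE z in circle. f z = g z" for f g
    using AE_circle_cnj[OF that] by eventually_elim (simp add: star_def)
qed

lemma star_op_star_op [simp]: "star_op (star_op f) = f"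
  by transfer (simp add: square_integrable_star, simp add: star_def)

lemma star_op_add: "star_op (f + g) = star_op f + star_op g"
  by transfer (simp add: square_integrable_star square_integrable_add, simp add: star_def)

lemma star_op_scaleC: "star_op (scaleC c f) = scaleC (cnj c) (star_op f)"
  by transfer (simp add: square_integrable_star square_integrable_cmult, simp add: star_def)

lemma cinner_star_op_star_op: "cinner (star_op f) (star_op g) = cinner g f"
proof (transfer, goal_cases)
  case (1 f g)
  hence [measurable]: "f \<in> borel_measurable borel" "g \<in> borel_measurable borel"
    by (auto simp: square_integrable_def)
  show ?case
    using integral_circle_cnj[of "\<lambda>z. g z * cnj (f z)"] by (simp add: star_def mult.commute)
qed

lemma cinner_star_op_left: "cinner (star_op f) g = cinner (star_op g) f"
  using cinner_star_op_star_op[of f "star_op g"] by simp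

lemma star_op_orth_compl:
  assumes "\<And>g. g \<in> M \<Longrightarrow> star_op g \<in> M" "f \<in> orth_compl M"
  shows "star_op f \<in> orth_compl M"
  unfolding orth_compl_def
proof clarify
  fix g assume "g \<in> M"
  hence "cinner f (star_op g) = 0" using assms by (simp add: orth_compl_def)
  thus "cinner (star_op f) g = 0"
    by (subst cinner_star_op_left, subst cinner_commute) simp
qed

lemma star_op_monomial: "star_op (monomial n) = monomial n"
  by transfer (use monomial.rsp in \<open>auto simp: square_integrable_star rel_fun_def star_def\<close>)

lemma star_op_H2: "f \<in> H2 \<Longrightarrow> star_op f \<in> H2"
  unfolding H2_eq_orth_compl by (rule star_op_orth_compl) (auto simp: star_op_monomial)

lemma star_op_mult_op:
  assumes "ess_bounded \<theta>" "AE z in circle. star \<theta> z = \<theta> z"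
  shows "star_op (mult_op \<theta> f) = mult_op \<theta> (star_op f)"
  using assms
proof (transfer, goal_cases)
  case (1 \<theta> f)
  have "AE z in circle. star (\<lambda>z. \<theta> z * f z) z = \<theta> z * star f z"
    using 1(2) by eventually_elim (simp add: star_def)
  thus ?case using 1 by (auto intro!: square_integrable_mult square_integrable_star)
qed

lemma star_op_model_space:
  assumes "inner_function \<theta>" "AE z in circle. star \<theta> z = \<theta> z" "f \<in> model_space \<theta>"
  shows "star_op f \<in> model_space \<theta>"
proof -
  have "star_op g \<in> mult_op \<theta> ` H2" if "g \<in> mult_op \<theta> ` H2" for g
    using that assms(2) inner_function_imp_ess_bounded(1)[OF assms(1)]
    by (auto simp: star_op_mult_op star_op_H2)
  thus ?thesis
    using assms(3) star_op_H2 star_op_orth_compl[of "mult_op \<theta> ` H2" f]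
    by (auto simp: model_space_def)
qed

lemma star_op_orth_compl_model_space:
  assumes "inner_function \<theta>" "AE z in circle. star \<theta> z = \<theta> z" "f \<in> orth_compl (model_space \<theta>)"
  shows "star_op f \<in> orth_compl (model_space \<theta>)"
  using star_op_orth_compl[of "model_space \<theta>", OF star_op_model_space[OF assms(1,2)] assms(3)] .

text \<open>Conjugating \<open>J M\<^sub>\<phi>\<close> by the star operation turns it into its adjoint.\<close>
lemma star_op_flip_op_mult_op:
  assumes "ess_bounded \<phi>"
  shows "star_op (flip_op (mult_op \<phi> (star_op f))) = mult_op (\<lambda>z. cnj (\<phi> z)) (flip_op f)"
proof -
  have "ess_bounded (\<lambda>z. cnj (\<phi> z))"
    by (rule ess_bounded_cnj[OF assms])
  with assms show ?thesis
  proof (transfer, goal_cases)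
    case (1 \<phi> f)
    hence "square_integrable (star (\<lambda>z. \<phi> (cnj z) * star f (cnj z)))"
        "square_integrable (\<lambda>z. cnj (\<phi> z) * f (cnj z))"
      by (auto intro!: square_integrable_star square_integrable_mult square_integrable_flip
            square_integrable_flip[of "\<lambda>z. \<phi> z * star f z"])
    thus ?case using 1 by (simp add: star_def)
  qed
qed

text \<open>The projection is removed on one side, the symbol and the flip are moved across the inner
  product, and the projection is reinserted on the other side. Reinserting it is possible
  because the star operation maps the orthogonal complement of the model space into itself; this is
  where \<open>\<theta>\<^sup>* = \<theta>\<close> enters.\<close>
lemma cinner_dual_truncated_Hankel:
  assumes \<theta>: "inner_function \<theta>" "AE z in circle. star \<theta> z = \<theta> z" and \<phi>: "ess_bounded \<phi>"
    and x: "x \<in> orth_compl (model_space \<theta>)" and y: "y \<in> orth_compl (model_space \<theta>)"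
  shows "cinner (dual_truncated_Hankel \<theta> \<phi> x) y
       = cinner x (star_op (dual_truncated_Hankel \<theta> \<phi> (star_op y)))"
proof -
  have Cx: "star_op x \<in> orth_compl (model_space \<theta>)"
    by (rule star_op_orth_compl_model_space[OF \<theta> x])
  have "cinner (dual_truncated_Hankel \<theta> \<phi> x) y = cinner (flip_op (mult_op \<phi> x)) y"
    by (simp add: dual_truncated_Hankel_def cinner_Q_inner_left \<theta>(1) y)
  also have "\<dots> = cinner x (mult_op (\<lambda>z. cnj (\<phi> z)) (flip_op y))"
    by (simp add: cinner_flip_op_left cinner_mult_op_left \<phi>)
  also have "\<dots> = cinner x (star_op (flip_op (mult_op \<phi> (star_op y))))"
    by (simp add: star_op_flip_op_mult_op \<phi>)
  also have "\<dots> = cinner (flip_op (mult_op \<phi> (star_op y))) (star_op x)"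
    using cinner_star_op_star_op[of "star_op x"] by simp
  also have "\<dots> = cinner (dual_truncated_Hankel \<theta> \<phi> (star_op y)) (star_op x)"
    by (simp add: dual_truncated_Hankel_def cinner_Q_inner_left \<theta>(1) Cx)
  also have "\<dots> = cinner x (star_op (dual_truncated_Hankel \<theta> \<phi> (star_op y)))"
    using cinner_star_op_star_op[of "star_op x"] by simp
  finally show ?thesis .
qed

theorem theorem4p10:
  fixes \<theta> \<phi> :: "complex \<Rightarrow> complex"
  assumes "inner_function \<theta>"
    and "AE z in circle. star \<theta> z = \<theta> z"
    and "ess_bounded \<phi>"
    and "hyponormal_on (orth_compl (model_space \<theta>)) (dual_truncated_Hankel \<theta> \<phi>)"
  shows "normal_on (orth_compl (model_space \<theta>)) (dual_truncated_Hankel \<theta> \<phi>)"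
proof (rule complex_symmetric_hyponormal_imp_normal[where C = star_op])
  fix x assume "x \<in> orth_compl (model_space \<theta>)"
  thus "star_op x \<in> orth_compl (model_space \<theta>)"
    by (rule star_op_orth_compl_model_space[OF assms(1,2)])
next
  fix x y assume "x \<in> orth_compl (model_space \<theta>)" "y \<in> orth_compl (model_space \<theta>)"
  thus "cinner (dual_truncated_Hankel \<theta> \<phi> x) y
      = cinner x (star_op (dual_truncated_Hankel \<theta> \<phi> (star_op y)))"
    by (rule cinner_dual_truncated_Hankel[OF assms(1-3)])
qed (use assms(4) in \<open>auto intro: complex_subspace_orth_compl
        simp: star_op_add star_op_scaleC cinner_star_op_star_op\<close>)

end
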